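(* Let $G_0$ be a group acting decently on a set $X_0$ with basepoint $x_0$. Let $H$ be a group acting on a set $P$, and let $\Gamma<G^{\oplus}$ be a finitely generated subgroup acting purely elliptically on $X=X_0^{\oplus P}$. Suppose that $\mathrm{proj}_H(\Gamma)$ has a normal series $N_1<N_2<\cdots<N_n=\mathrm{proj}_H(\Gamma)$ (each $N_i$ normal in $\mathrm{proj}_H(\Gamma)$) such that, with $N_0$ the trivial group, each quotient $N_i/N_{i-1}$, $1\le i\le n$, is abelian, and such that there exists $t\in N_1$ with only finitely many finite orbits on $P$. Then $\Gamma$ fixes a point of $X$.
   Context: **Decent action.** An action of a group $G$ on a set $Y$ is *purely elliptic* if every element of $G$ fixes a point of $Y$. An action of $G$ on $Y$ is *decent* if: (1) every subgroup of $G$ with a finite orbit on $Y$ fixes a point of $Y$; and (2) every finitely generated subgroup of $G$ acting purely elliptically on $Y$ fixes a point of $Y$. **Restricted product.** $X=X_0^{\oplus P}$ is the set of all $(y_p)_p\in\prod_{p\in P}X_0$ such that $y_p=x_0$ for all but finitely many $p\in P$. **The group $G^{\oplus}$.** Given actions of $H$ on $P$ and of $G_0$ on $X_0$, the unrestricted wreath product $G_0\wr_P H=\prod_P G_0\rtimes H$ acts on $\prod_P X_0$ by $(ghx)_p=g_p\,x_{h^{-1}p}$ for $g\in\prod_P G_0$, $h\in H$, $x=(x_p)_p\in\prod_P X_0$. $G^{\oplus}$ denotes the subgroup of $G_0\wr_P H$ preserving $X$. For $\Gamma<G_0\wr_P H$, $\mathrm{proj}_H(\Gamma)$ is the image of $\Gamma$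 under the projection homomorphism $\prod_P G_0\rtimes H\to H$. The orbits of an element $t\in H$ on $P$ are the orbits of the cyclic group $\langle t\rangle$. *)

theory Defs
  imports "HOL-Algebra.Group_Action" "HOL-Algebra.Generated_Groups" "HOL-Algebra.Product_Groups"
begin

section \<open>Decent actions\<close>

definition finitely_generated :: "('a, 'm) monoid_scheme \<Rightarrow> bool" where
  "finitely_generated G \<longleftrightarrow> (\<exists>S. finite S \<and> S \<subseteq> carrier G \<and> generate G S = carrier G)"

text \<open>
  As with \<^const>\<open>orbit\<close>, only the carrier of \<open>G\<close> matters in the next two definitions, so a
  subgroup \<open>K\<close> is passed as \<open>G\<lparr>carrier := K\<rparr>\<close>, and \<open>\<phi>\<close> is only ever applied to points of \<open>Y\<close>.
\<close>

definition has_global_fixed_point ::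
    "('a, 'm) monoid_scheme \<Rightarrow> 'y set \<Rightarrow> ('a \<Rightarrow> 'y \<Rightarrow> 'y) \<Rightarrow> bool" where
  "has_global_fixed_point G Y \<phi> \<longleftrightarrow> (\<exists>y\<in>Y. \<forall>g\<in>carrier G. \<phi> g y = y)"

definition purely_elliptic ::
    "('a, 'm) monoid_scheme \<Rightarrow> 'y set \<Rightarrow> ('a \<Rightarrow> 'y \<Rightarrow> 'y) \<Rightarrow> bool" where
  "purely_elliptic G Y \<phi> \<longleftrightarrow> (\<forall>g\<in>carrier G. \<exists>y\<in>Y. \<phi> g y = y)"

locale decent_action = group_action G Y \<phi> for G (structure) and Y and \<phi> +
  assumes finite_orbit_imp_fixed_point:
      "\<lbrakk>subgroup K G; y \<in> Y; finite (orbit (G\<lparr>carrier := K\<rparr>) \<phi> y)\<rbrakk>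
        \<Longrightarrow> has_global_fixed_point (G\<lparr>carrier := K\<rparr>) Y \<phi>"
    and purely_elliptic_imp_fixed_point:
      "\<lbrakk>subgroup K G; finitely_generated (G\<lparr>carrier := K\<rparr>);
        purely_elliptic (G\<lparr>carrier := K\<rparr>) Y \<phi>\<rbrakk>
        \<Longrightarrow> has_global_fixed_point (G\<lparr>carrier := K\<rparr>) Y \<phi>"


section \<open>The unrestricted wreath product and its action\<close>

text \<open>
  The pair \<open>(g, h)\<close> stands for the product \<open>gh\<close>, where \<open>g\<close> is in the base group \<open>\<Prod>\<^sub>P G\<^sub>0\<close> and
  \<open>h\<close> in \<open>H\<close>. The action \<open>\<psi>\<close> of \<open>H\<close> on \<open>P\<close> induces the action \<open>(h g h\<inverse>)\<^sub>p = g\<^bsub>h\<inverse>p\<^esub>\<close> on the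
  base group, whence \<open>(gh)(g'h') = (g (h g' h\<inverse>)) (hh')\<close>.
\<close>

definition wreath_product ::
    "('g, 'm) monoid_scheme \<Rightarrow> ('h, 'n) monoid_scheme \<Rightarrow> 'p set \<Rightarrow> ('h \<Rightarrow> 'p \<Rightarrow> 'p)
      \<Rightarrow> (('p \<Rightarrow> 'g) \<times> 'h) monoid" where
  "wreath_product G\<^sub>0 H P \<psi> =
    \<lparr>carrier = carrier (product_group P (\<lambda>_. G\<^sub>0)) \<times> carrier H,
     monoid.mult = (\<lambda>(g, h) (g', h').
       (g \<otimes>\<^bsub>product_group P (\<lambda>_. G\<^sub>0)\<^esub> (\<lambda>p\<in>P. g' (\<psi> (inv\<^bsub>H\<^esub> h) p)), h \<otimes>\<^bsub>H\<^esub> h')),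
     monoid.one = (\<one>\<^bsub>product_group P (\<lambda>_. G\<^sub>0)\<^esub>, \<one>\<^bsub>H\<^esub>)\<rparr>"

definition wreath_action ::
    "('h, 'n) monoid_scheme \<Rightarrow> 'p set \<Rightarrow> 'x set \<Rightarrow> ('g \<Rightarrow> 'x \<Rightarrow> 'x) \<Rightarrow> ('h \<Rightarrow> 'p \<Rightarrow> 'p)
      \<Rightarrow> ('p \<Rightarrow> 'g) \<times> 'h \<Rightarrow> ('p \<Rightarrow> 'x) \<Rightarrow> ('p \<Rightarrow> 'x)" where
  "wreath_action H P X\<^sub>0 \<phi> \<psi> =
    (\<lambda>(g, h). \<lambda>x\<in>(\<Pi>\<^sub>E p\<in>P. X\<^sub>0). \<lambda>p\<in>P. \<phi> (g p) (x (\<psi> (inv\<^bsub>H\<^esub> h) p)))"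

definition restricted_product :: "'p set \<Rightarrow> 'x set \<Rightarrow> 'x \<Rightarrow> ('p \<Rightarrow> 'x) set" where
  "restricted_product P X\<^sub>0 x\<^sub>0 = {y \<in> (\<Pi>\<^sub>E p\<in>P. X\<^sub>0). finite {p \<in> P. y p \<noteq> x\<^sub>0}}"

text \<open>The group \<open>G\<^sup>\<oplus>\<close>: the setwise stabilizer of the restricted product in the wreath product.\<close>

definition preserving_wreath_product ::
    "('g, 'm) monoid_scheme \<Rightarrow> 'x set \<Rightarrow> ('g \<Rightarrow> 'x \<Rightarrow> 'x) \<Rightarrow> 'x
      \<Rightarrow> ('h, 'n) monoid_scheme \<Rightarrow> 'p set \<Rightarrow> ('h \<Rightarrow> 'p \<Rightarrow> 'p) \<Rightarrow> (('p \<Rightarrow> 'g) \<times> 'h) monoid" where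
  "preserving_wreath_product G\<^sub>0 X\<^sub>0 \<phi> x\<^sub>0 H P \<psi> =
    (wreath_product G\<^sub>0 H P \<psi>)
      \<lparr>carrier := {\<gamma> \<in> carrier (wreath_product G\<^sub>0 H P \<psi>).
         wreath_action H P X\<^sub>0 \<phi> \<psi> \<gamma> ` restricted_product P X\<^sub>0 x\<^sub>0 = restricted_product P X\<^sub>0 x\<^sub>0}\<rparr>"


subsection \<open>These are groups and actions\<close>

locale wreath_data =
  A: group_action G\<^sub>0 X\<^sub>0 \<phi> + B: group_action H P \<psi>
  for G\<^sub>0 :: "('g, 'm) monoid_scheme" and X\<^sub>0 :: "'x set" and \<phi>
    and H :: "('h, 'n) monoid_scheme" and P :: "'p set" and \<psi>
begin

sublocale G\<^sub>0: group G\<^sub>0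
  using A.group_hom group_hom.axioms(1) by blast

sublocale H: group H
  using B.group_hom group_hom.axioms(1) by blast

abbreviation "W \<equiv> wreath_product G\<^sub>0 H P \<psi>"
abbreviation "act \<equiv> wreath_action H P X\<^sub>0 \<phi> \<psi>"

lemma psi_closed [simp]: "h \<in> carrier H \<Longrightarrow> p \<in> P \<Longrightarrow> \<psi> h p \<in> P"
  using B.element_image by blast

lemma phi_closed [simp]: "g \<in> carrier G\<^sub>0 \<Longrightarrow> x \<in> X\<^sub>0 \<Longrightarrow> \<phi> g x \<in> X\<^sub>0"
  using A.element_image by blast

lemma psi_one [simp]: "p \<in> P \<Longrightarrow> \<psi> \<one>\<^bsub>H\<^esub> p = p"
  by (metis B.id_eq_one restrict_apply')

lemma phi_one [simp]: "x \<in> X\<^sub>0 \<Longrightarrow> \<phi> \<one>\<^bsub>G\<^sub>0\<^esub> x = x"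
  by (metis A.id_eq_one restrict_apply')

lemma psi_inv_mult [simp]:
  "\<lbrakk>h \<in> carrier H; h' \<in> carrier H; p \<in> P\<rbrakk>
    \<Longrightarrow> \<psi> (inv\<^bsub>H\<^esub> (h \<otimes>\<^bsub>H\<^esub> h')) p = \<psi> (inv\<^bsub>H\<^esub> h') (\<psi> (inv\<^bsub>H\<^esub> h) p)"
  by (simp add: H.inv_mult_group B.composition_rule)

lemma psi_psi_inv [simp]:
  "\<lbrakk>h \<in> carrier H; p \<in> P\<rbrakk> \<Longrightarrow> \<psi> h (\<psi> (inv\<^bsub>H\<^esub> h) p) = p"
  by (simp flip: B.composition_rule)

lemma group_wreath_product: "group W"
proof (rule groupI)
  fix x assume "x \<in> carrier W"
  then obtain g h where x: "x = (g, h)" "g \<in> P \<rightarrow>\<^sub>E carrier G\<^sub>0" "h \<in> carrier H"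
    by (auto simp: wreath_product_def)
  let ?y = "(\<lambda>p\<in>P. inv\<^bsub>G\<^sub>0\<^esub> (g (\<psi> h p)), inv\<^bsub>H\<^esub> h)"
  have "?y \<in> carrier W"
    using x by (auto simp: wreath_product_def PiE_iff)
  moreover have "?y \<otimes>\<^bsub>W\<^esub> x = \<one>\<^bsub>W\<^esub>"
    using x by (auto simp: wreath_product_def PiE_iff fun_eq_iff restrict_def)
  ultimately show "\<exists>y\<in>carrier W. y \<otimes>\<^bsub>W\<^esub> x = \<one>\<^bsub>W\<^esub>" by blast
qed (auto simp: wreath_product_def PiE_iff fun_eq_iff restrict_def G\<^sub>0.m_assoc H.m_assoc
       extensional_def)

lemma act_closed:
  "\<lbrakk>\<gamma> \<in> carrier W; x \<in> P \<rightarrow>\<^sub>E X\<^sub>0\<rbrakk> \<Longrightarrow> act \<gamma> x \<in> P \<rightarrow>\<^sub>E X\<^sub>0"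
  by (auto simp: wreath_product_def wreath_action_def PiE_iff)

lemma act_one: "x \<in> P \<rightarrow>\<^sub>E X\<^sub>0 \<Longrightarrow> act \<one>\<^bsub>W\<^esub> x = x"
  by (auto simp: wreath_product_def wreath_action_def PiE_iff fun_eq_iff extensional_def)

lemma act_mult:
  assumes "\<gamma> \<in> carrier W" "\<delta> \<in> carrier W" "x \<in> P \<rightarrow>\<^sub>E X\<^sub>0"
  shows "act (\<gamma> \<otimes>\<^bsub>W\<^esub> \<delta>) x = act \<gamma> (act \<delta> x)"
proof -
  obtain g h where \<gamma>: "\<gamma> = (g, h)" by (cases \<gamma>)
  obtain g' h' where \<delta>: "\<delta> = (g', h')" by (cases \<delta>)
  have d: "act \<delta> x \<in> P \<rightarrow>\<^sub>E X\<^sub>0" using assms act_closed by blast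
  show ?thesis
    using assms d unfolding \<gamma> \<delta>
    by (auto simp: wreath_product_def wreath_action_def fun_eq_iff PiE_iff A.composition_rule)
qed

lemma act_bij: "\<gamma> \<in> carrier W \<Longrightarrow> bij_betw (act \<gamma>) (P \<rightarrow>\<^sub>E X\<^sub>0) (P \<rightarrow>\<^sub>E X\<^sub>0)"
proof -
  interpret W: group W by (rule group_wreath_product)
  assume \<gamma>: "\<gamma> \<in> carrier W"
  show ?thesis
  proof (rule bij_betw_byWitness[where f' = "act (inv\<^bsub>W\<^esub> \<gamma>)"])
    show "\<forall>x\<in>P \<rightarrow>\<^sub>E X\<^sub>0. act (inv\<^bsub>W\<^esub> \<gamma>) (act \<gamma> x) = x"
      using \<gamma> by (simp add: act_one flip: act_mult)
    show "\<forall>x\<in>P \<rightarrow>\<^sub>E X\<^sub>0. act \<gamma> (act (inv\<^bsub>W\<^esub> \<gamma>) x) = x"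
      using \<gamma> by (simp add: act_one flip: act_mult)
  qed (use \<gamma> act_closed in blast)+
qed

lemma group_action_wreath_product: "group_action W (P \<rightarrow>\<^sub>E X\<^sub>0) act"
proof -
  have Bij: "act \<gamma> \<in> Bij (P \<rightarrow>\<^sub>E X\<^sub>0)" if "\<gamma> \<in> carrier W" for \<gamma>
    using act_bij[OF that] by (auto simp: Bij_def wreath_action_def split: prod.split)
  moreover have "act (\<gamma> \<otimes>\<^bsub>W\<^esub> \<delta>) = compose (P \<rightarrow>\<^sub>E X\<^sub>0) (act \<gamma>) (act \<delta>)"
    if "\<gamma> \<in> carrier W" "\<delta> \<in> carrier W" for \<gamma> \<delta>
  proof (rule extensionalityI[of _ "P \<rightarrow>\<^sub>E X\<^sub>0"])
    show "act (\<gamma> \<otimes>\<^bsub>W\<^esub> \<delta>) \<in> extensional (P \<rightarrow>\<^sub>E X\<^sub>0)"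
      by (auto simp: wreath_action_def split: prod.split)
  qed (auto simp: compose_eq act_mult that)
  ultimately show ?thesis
    by (auto intro!: group_action.intro group_hom.intro group_wreath_product group_BijGroup
        group_hom_axioms.intro homI simp: BijGroup_def)
qed

lemma subgroup_preserving:
  "subgroup (carrier (preserving_wreath_product G\<^sub>0 X\<^sub>0 \<phi> x\<^sub>0 H P \<psi>)) W"
proof -
  interpret W: group W by (rule group_wreath_product)
  let ?X = "restricted_product P X\<^sub>0 x\<^sub>0"
  have sub: "?X \<subseteq> P \<rightarrow>\<^sub>E X\<^sub>0" by (auto simp: restricted_product_def)
  have one: "act \<one>\<^bsub>W\<^esub> ` ?X = ?X"
    using sub act_one by force
  have mult: "act (\<gamma> \<otimes>\<^bsub>W\<^esub> \<delta>) ` ?X = act \<gamma> ` (act \<delta> ` ?X)"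
    if "\<gamma> \<in> carrier W" "\<delta> \<in> carrier W" for \<gamma> \<delta>
    unfolding image_image using that sub by (intro image_cong refl act_mult) auto
  have inv: "act (inv\<^bsub>W\<^esub> \<gamma>) ` ?X = ?X" if "\<gamma> \<in> carrier W" "act \<gamma> ` ?X = ?X" for \<gamma>
    using mult[of "inv\<^bsub>W\<^esub> \<gamma>" \<gamma>] that one by simp
  show ?thesis
    by (rule subgroup.intro) (auto simp: preserving_wreath_product_def mult inv one)
qed

end

end

theory Submission
  imports Defs
begin

text \<open>
  A point of \<open>X\<close> is fixed by \<open>\<Gamma>\<close> as soon as its restriction to each \<open>\<Gamma>\<close>-orbit on \<open>P\<close> is, so the
  finite and the infinite \<open>\<Gamma>\<close>-orbits can be treated by different means.

  On the infinite orbits, let \<open>\<tau> \<in> \<Gamma>\<close> lie above \<open>t\<close> and let \<open>y \<in> X\<close> be fixed by \<open>\<tau>\<close>. The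
  elements with a finite \<open>t\<close>-orbit form a finite set that the abelian group \<open>N\<^sub>1\<close> preserves.
  Every conjugate of \<open>t\<close> in the projection of \<open>\<Gamma>\<close> lies in \<open>N\<^sub>1\<close>, hence has finite orbits there;
  moving such a finite orbit back by the conjugating element shows that the finite \<open>t\<close>-orbits
  fill whole \<open>\<Gamma>\<close>-orbits, which are therefore finite
  (\<open>infinite_cyclic_orbit_if_infinite_orbit\<close>). So \<open>t\<close> has only infinite orbits inside an
  infinite \<open>\<Gamma>\<close>-orbit. There the point \<open>y\<close> is rigid: two \<open>\<tau>\<close>-fixed points of \<open>X\<close> agree far out
  along a \<open>\<tau>\<close>-orbit, because both equal \<open>x\<^sub>0\<close>, and agreement propagates back along the orbit
  (\<open>fixed_point_unique_on_infinite_orbit\<close>).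

  Rigidity turns statements about \<open>\<sigma>\<tau>\<sigma>\<inverse>\<close> into statements about \<open>\<sigma>\<close>: if \<open>\<sigma>\<tau>\<sigma>\<inverse>\<close> fixes \<open>y\<close>, then
  \<open>\<sigma>\<inverse>y\<close> is another \<open>\<tau>\<close>-fixed point and so equals \<open>y\<close> (\<open>fixes_over_if_conjugate_fixes\<close>). The
  chain starts at an element \<open>k\<close> of \<open>\<Gamma>\<close> that acts trivially on \<open>P\<close>. Such a \<open>k\<close> changes \<open>y\<close> at only
  finitely many coordinates; let \<open>p\<close> be one of them on an infinite \<open>\<tau>\<close>-orbit. For large \<open>j\<close>, the
  orbit of \<open>p\<close> under \<open>\<tau>\<^sup>j\<close> contains no other. A fixed point of \<open>k\<tau>\<^sup>j\<close>, which exists by pure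
  ellipticity, equals \<open>x\<^sub>0\<close> at both ends of the orbit, so it equals \<open>y\<close> from \<open>p\<close> on as well as before \<open>p\<close>, and then \<open>k\<close> cannot change \<open>y\<close> at \<open>p\<close> after all
  (\<open>unmoving_element_fixes_infinite_orbits\<close>). If \<open>\<sigma> \<in> \<Gamma>\<close> lies above \<open>N\<^sub>1\<close>, then \<open>\<sigma>\<tau>\<sigma>\<inverse> = k\<tau>\<close> for
  such a \<open>k\<close>, so \<open>\<sigma>\<close> fixes \<open>y\<close>; for arbitrary \<open>\<sigma> \<in> \<Gamma>\<close>, the conjugate \<open>\<sigma>\<tau>\<sigma>\<inverse>\<close> lies above \<open>N\<^sub>1\<close>, so
  \<open>\<sigma>\<close> fixes \<open>y\<close> as well.

  On a finite orbit, the stabilizer in \<open>\<Gamma>\<close> of an element \<open>p\<close> has finite index, so it is finitely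
  generated by Schreier's argument. It acts on the copy of \<open>X\<^sub>0\<close> at \<open>p\<close> through a finitely
  generated, purely elliptic group, which fixes a point since the action of \<open>G\<^sub>0\<close> is decent;
  translating this point around the orbit gives the restriction that is sought
  (\<open>fixed_point_over_finite_orbit\<close>). All but finitely many orbits avoid the coordinates at which
  some generator moves \<open>x\<^sub>0\<close>; there the constant \<open>x\<^sub>0\<close> is fixed, which keeps the assembled point
  inside the restricted product (\<open>global_fixed_point\<close>).
\<close>

section \<open>Groups acting on a product by moving coordinates\<close>

text \<open>
  The wreath product enters the argument only through the permutation \<open>\<theta> g\<close> of the coordinates
  and the element \<open>\<alpha> g p\<close> of \<open>G\<^sub>0\<close> by which \<open>g\<close> carries the copy of \<open>X\<^sub>0\<close> at \<open>p\<close> to the copy at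
  \<open>\<theta> g p\<close>. Indexing \<open>\<alpha>\<close> by the source \<open>p\<close>, not by the target, makes it a cocycle and keeps
  inverses out of the formulas.
\<close>
locale coordinate_action =
  group \<Gamma> + G\<^sub>0: group_action G\<^sub>0 X\<^sub>0 \<phi>
  for \<Gamma> :: "('a, 'k) monoid_scheme" (structure)
    and G\<^sub>0 :: "('g, 'm) monoid_scheme" and X\<^sub>0 :: "'x set" and \<phi> +
  fixes P :: "'p set" and \<theta> :: "'a \<Rightarrow> 'p \<Rightarrow> 'p" and \<alpha> :: "'a \<Rightarrow> 'p \<Rightarrow> 'g" and x\<^sub>0 :: 'x
  assumes move_closed [simp]: "\<lbrakk>g \<in> carrier \<Gamma>; p \<in> P\<rbrakk> \<Longrightarrow> \<theta> g p \<in> P"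
    and move_one [simp]: "p \<in> P \<Longrightarrow> \<theta> \<one> p = p"
    and move_mult: "\<lbrakk>g \<in> carrier \<Gamma>; h \<in> carrier \<Gamma>; p \<in> P\<rbrakk> \<Longrightarrow> \<theta> (g \<otimes> h) p = \<theta> g (\<theta> h p)"
    and coord_closed [simp]: "\<lbrakk>g \<in> carrier \<Gamma>; p \<in> P\<rbrakk> \<Longrightarrow> \<alpha> g p \<in> carrier G\<^sub>0"
    and coord_mult: "\<lbrakk>g \<in> carrier \<Gamma>; h \<in> carrier \<Gamma>; p \<in> P\<rbrakk>
          \<Longrightarrow> \<alpha> (g \<otimes> h) p = \<alpha> g (\<theta> h p) \<otimes>\<^bsub>G\<^sub>0\<^esub> \<alpha> h p"
    and base_in [simp]: "x\<^sub>0 \<in> X\<^sub>0"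
    and finite_base_moved: "g \<in> carrier \<Gamma> \<Longrightarrow> finite {p \<in> P. \<phi> (\<alpha> g p) x\<^sub>0 \<noteq> x\<^sub>0}"
begin

sublocale G\<^sub>0: group G\<^sub>0
  using G\<^sub>0.group_hom group_hom.axioms(1) by blast

abbreviation "\<beta> g p \<equiv> \<phi> (\<alpha> g p)"

abbreviation "X \<equiv> restricted_product P X\<^sub>0 x\<^sub>0"

abbreviation "cyclic_orbit g p \<equiv> range (\<lambda>k::int. \<theta> (g [^] k) p)"

text \<open>
  If \<open>\<theta> g\<close> preserves \<open>A\<close>, this is the condition that \<open>g\<close> fixes the restriction of \<open>y\<close> to \<open>A\<close>.
  It makes sense for functions \<open>y\<close> that are unconstrained outside \<open>A\<close>.
\<close>
definition fixes_over :: "'p set \<Rightarrow> ('p \<Rightarrow> 'x) \<Rightarrow> 'a \<Rightarrow> bool" where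
  "fixes_over A y g \<longleftrightarrow> (\<forall>p\<in>A. \<beta> g p (y p) = y (\<theta> g p))"

lemma fixes_overD: "\<lbrakk>fixes_over A y g; p \<in> A\<rbrakk> \<Longrightarrow> \<beta> g p (y p) = y (\<theta> g p)"
  by (simp add: fixes_over_def)

definition invariant :: "'p set \<Rightarrow> bool" where
  "invariant A \<longleftrightarrow> A \<subseteq> P \<and> (\<forall>g\<in>carrier \<Gamma>. \<forall>p\<in>A. \<theta> g p \<in> A)"

lemma invariant_subset: "\<lbrakk>invariant A; p \<in> A\<rbrakk> \<Longrightarrow> p \<in> P"
  by (auto simp: invariant_def)

lemma invariant_closed: "\<lbrakk>invariant A; g \<in> carrier \<Gamma>; p \<in> A\<rbrakk> \<Longrightarrow> \<theta> g p \<in> A"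
  by (auto simp: invariant_def)

lemma move_inv_move [simp]: "\<lbrakk>g \<in> carrier \<Gamma>; p \<in> P\<rbrakk> \<Longrightarrow> \<theta> (inv g) (\<theta> g p) = p"
  by (simp flip: move_mult)

lemma move_move_inv [simp]: "\<lbrakk>g \<in> carrier \<Gamma>; p \<in> P\<rbrakk> \<Longrightarrow> \<theta> g (\<theta> (inv g) p) = p"
  by (simp flip: move_mult)

lemma inj_on_move: "g \<in> carrier \<Gamma> \<Longrightarrow> inj_on (\<theta> g) P"
  by (rule inj_on_inverseI[where g = "\<theta> (inv g)"]) simp

lemma move_int_pow_add:
  "\<lbrakk>g \<in> carrier \<Gamma>; p \<in> P\<rbrakk> \<Longrightarrow> \<theta> (g [^] (m + k :: int)) p = \<theta> (g [^] m) (\<theta> (g [^] k) p)"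
  by (simp add: int_pow_mult move_mult)

lemma coord_one [simp]: "p \<in> P \<Longrightarrow> \<alpha> \<one> p = \<one>\<^bsub>G\<^sub>0\<^esub>"
  using coord_mult[of \<one> \<one> p] by (simp add: G\<^sub>0.l_cancel_one')

lemma act_coord_closed [simp]: "\<lbrakk>g \<in> carrier \<Gamma>; p \<in> P; x \<in> X\<^sub>0\<rbrakk> \<Longrightarrow> \<beta> g p x \<in> X\<^sub>0"
  using G\<^sub>0.element_image coord_closed by blast

lemma act_coord_mult:
  "\<lbrakk>g \<in> carrier \<Gamma>; h \<in> carrier \<Gamma>; p \<in> P; x \<in> X\<^sub>0\<rbrakk>
    \<Longrightarrow> \<beta> (g \<otimes> h) p x = \<beta> g (\<theta> h p) (\<beta> h p x)"
  by (simp add: coord_mult G\<^sub>0.composition_rule)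

lemma phi_one [simp]: "x \<in> X\<^sub>0 \<Longrightarrow> \<phi> \<one>\<^bsub>G\<^sub>0\<^esub> x = x"
  by (metis G\<^sub>0.id_eq_one restrict_apply')

lemma act_coord_inv [simp]:
  "\<lbrakk>g \<in> carrier \<Gamma>; p \<in> P; x \<in> X\<^sub>0\<rbrakk> \<Longrightarrow> \<beta> (inv g) (\<theta> g p) (\<beta> g p x) = x"
  by (simp flip: act_coord_mult)

lemma act_coord_inj:
  "\<lbrakk>g \<in> carrier \<Gamma>; p \<in> P; x \<in> X\<^sub>0; x' \<in> X\<^sub>0\<rbrakk> \<Longrightarrow> \<beta> g p x = \<beta> g p x' \<longleftrightarrow> x = x'"
  by (metis act_coord_inv)

lemma subgroup_fixes_over:
  assumes A: "invariant A" and y: "\<And>p. p \<in> A \<Longrightarrow> y p \<in> X\<^sub>0"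
  shows "subgroup {g \<in> carrier \<Gamma>. fixes_over A y g} \<Gamma>"
proof (rule subgroupI)
  fix g assume "g \<in> {g \<in> carrier \<Gamma>. fixes_over A y g}"
  then have g: "g \<in> carrier \<Gamma>" "fixes_over A y g" by auto
  have "\<beta> (inv g) p (y p) = y (\<theta> (inv g) p)" if p: "p \<in> A" for p
  proof -
    define q where "q = \<theta> (inv g) p"
    have q: "q \<in> A" "q \<in> P" "\<theta> g q = p"
      using A g p by (auto simp: q_def invariant_def)
    have "y p = \<beta> g q (y q)"
      using fixes_overD[OF g(2) q(1)] q(3) by simp
    then show ?thesis
      using act_coord_inv[OF g(1) q(2) y[OF q(1)]] q by (simp add: q_def)
  qed
  then show "inv g \<in> {g \<in> carrier \<Gamma>. fixes_over A y g}"
    using g by (auto simp: fixes_over_def)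
next
  fix g h assume "g \<in> {g \<in> carrier \<Gamma>. fixes_over A y g}" "h \<in> {g \<in> carrier \<Gamma>. fixes_over A y g}"
  then show "g \<otimes> h \<in> {g \<in> carrier \<Gamma>. fixes_over A y g}"
    using A y by (auto simp: fixes_over_def act_coord_mult move_mult invariant_def subset_iff)
next
  show "{g \<in> carrier \<Gamma>. fixes_over A y g} \<noteq> {}"
    using A y by (auto simp: fixes_over_def invariant_def subset_iff intro!: exI[of _ \<one>])
qed auto

lemma subgroup_move_stabilizer:
  assumes "p \<in> P"
  shows "subgroup {g \<in> carrier \<Gamma>. \<theta> g p = p} \<Gamma>"
proof (rule subgroupI)
  show "inv g \<in> {g \<in> carrier \<Gamma>. \<theta> g p = p}" if "g \<in> {g \<in> carrier \<Gamma>. \<theta> g p = p}" for g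
    using that assms move_inv_move[of g p] by auto
qed (use assms move_mult move_one in \<open>auto intro: exI[of _ \<one>]\<close>)

section \<open>Infinite cyclic orbits\<close>

text \<open>A coincidence between two powers makes the orbit periodic, hence finite.\<close>
lemma inj_int_pow_move:
  assumes g: "g \<in> carrier \<Gamma>" and p: "p \<in> P" and inf: "infinite (cyclic_orbit g p)"
  shows "inj (\<lambda>k::int. \<theta> (g [^] k) p)"
proof (rule ccontr)
  assume "\<not> inj (\<lambda>k::int. \<theta> (g [^] k) p)"
  then obtain k m :: int where km: "k < m" "\<theta> (g [^] k) p = \<theta> (g [^] m) p"
    unfolding inj_def by (metis linorder_neqE)
  define d where "d = m - k"
  have "\<theta> (g [^] d) p = \<theta> (g [^] (- k)) (\<theta> (g [^] m) p)"
    using g p by (simp add: d_def flip: move_int_pow_add)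
  also have "\<dots> = p"
    using g p by (simp flip: km(2) move_int_pow_add)
  finally have "g [^] d \<in> {g \<in> carrier \<Gamma>. \<theta> g p = p}"
    using g by simp
  then have per: "\<theta> ((g [^] d) [^] i) p = p" for i :: int
    using subgroup_int_pow_closed[OF subgroup_move_stabilizer[OF p]] by blast
  have "\<theta> (g [^] i) p = \<theta> (g [^] (i mod d)) p" for i
  proof -
    have "\<theta> (g [^] (i mod d + d * (i div d))) p = \<theta> (g [^] (i mod d)) (\<theta> (g [^] (d * (i div d))) p)"
      using g p by (rule move_int_pow_add)
    then show ?thesis
      using per[of "i div d"] g by (simp add: int_pow_pow)
  qed
  then have "cyclic_orbit g p \<subseteq> (\<lambda>i. \<theta> (g [^] i) p) ` {0..<d}"
    using km by (force simp: d_def)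
  with inf show False
    using finite_subset by blast
qed

text \<open>
  Fixed points are compared by applying this to the set \<open>D\<close> of coordinates at which they differ: a
  difference that is passed on along an infinite orbit cannot occur, since both points have all
  but finitely many coordinates equal to \<open>x\<^sub>0\<close>.
\<close>
lemma finite_absorbing_set_avoids_start:
  assumes "inj (f :: nat \<Rightarrow> 'b)" "finite D" "\<And>n. f n \<in> D \<Longrightarrow> f (Suc n) \<in> D"
  shows "f 0 \<notin> D"
proof
  assume "f 0 \<in> D"
  then have "f n \<in> D" for n by (induction n) (auto intro: assms)
  then have "range f \<subseteq> D" by auto
  with assms show False
    using finite_subset range_inj_infinite by blast
qed

text \<open>
  A difference at \<open>q\<close> forces a difference at \<open>\<theta> g q\<close>, because \<open>\<beta> g q\<close> is injective and carries
  the values of both points at \<open>q\<close> to their values at \<open>\<theta> g q\<close>.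
\<close>
lemma fixed_point_unique_on_infinite_orbit:
  assumes g: "g \<in> carrier \<Gamma>" and A: "invariant A" and p: "p \<in> A"
    and inf: "infinite (cyclic_orbit g p)"
    and y: "\<And>q. q \<in> A \<Longrightarrow> y q \<in> X\<^sub>0" "fixes_over A y g"
    and y': "\<And>q. q \<in> A \<Longrightarrow> y' q \<in> X\<^sub>0" "fixes_over A y' g"
    and fin: "finite {q \<in> A. y' q \<noteq> y q}"
  shows "y' p = y p"
proof -
  let ?f = "\<lambda>n::nat. \<theta> (g [^] int n) p"
  have pP: "p \<in> P" using A p by (rule invariant_subset)
  have "inj ?f"
    using inj_int_pow_move[OF g pP inf] unfolding inj_def by (metis of_nat_eq_iff)
  moreover have "?f (Suc n) \<in> {q \<in> A. y' q \<noteq> y q}" if "?f n \<in> {q \<in> A. y' q \<noteq> y q}" for n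
  proof -
    define q where "q = ?f n"
    have q: "q \<in> A" "q \<in> P" "y' q \<noteq> y q"
      using that A by (auto simp: q_def invariant_subset)
    have "?f (Suc n) = \<theta> g q"
      using g pP move_int_pow_add[of g p 1 "int n"] by (simp add: q_def)
    moreover have "y' (\<theta> g q) \<noteq> y (\<theta> g q)"
      using q g y y' act_coord_inj by (metis fixes_overD)
    ultimately show ?thesis
      using invariant_closed[OF A g q(1)] by simp
  qed
  ultimately have "?f 0 \<notin> {q \<in> A. y' q \<noteq> y q}"
    using fin by (rule_tac finite_absorbing_set_avoids_start) auto
  then show ?thesis using p pP by simp
qed

text \<open>
  Only finitely many powers of \<open>g\<close> bring \<open>p\<close> into \<open>S\<close>; every \<open>j\<close> beyond the largest absolute value
  of their exponents will do.
\<close>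
lemma exists_sparse_power:
  assumes g: "g \<in> carrier \<Gamma>" and p: "p \<in> P" and inf: "infinite (cyclic_orbit g p)"
    and S: "finite S"
  obtains j :: int where "j > 0" "\<And>m::int. m \<noteq> 0 \<Longrightarrow> \<theta> (g [^] (j * m)) p \<notin> S"
proof -
  define I where "I = {i::int. \<theta> (g [^] i) p \<in> S}"
  have "finite I"
    using finite_vimageI[OF S inj_int_pow_move[OF g p inf]] by (simp add: I_def vimage_def)
  then obtain b where b: "\<And>i. i \<in> I \<Longrightarrow> \<bar>i\<bar> \<le> b"
    by (metis (no_types) finite_imageI imageI Max_ge)
  show thesis
  proof
    show "max b 0 + 1 > 0" by simp
    fix m :: int assume "m \<noteq> 0"
    then have "\<bar>(max b 0 + 1) * m\<bar> \<ge> max b 0 + 1"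
      using mult_left_mono[of 1 "\<bar>m\<bar>" "max b 0 + 1"] by (simp add: abs_mult)
    then have "(max b 0 + 1) * m \<notin> I"
      using b[of "(max b 0 + 1) * m"] by linarith
    then show "\<theta> (g [^] ((max b 0 + 1) * m)) p \<notin> S"
      by (simp add: I_def)
  qed
qed

section \<open>Fixed points over the infinite orbits\<close>

lemma restricted_productD:
  assumes "y \<in> X"
  shows "p \<in> P \<Longrightarrow> y p \<in> X\<^sub>0" "finite {p \<in> P. y p \<noteq> x\<^sub>0}"
  using assms by (auto simp: restricted_product_def)

lemma finite_differing_coordinates:
  assumes "y \<in> X" "y' \<in> X" shows "finite {p \<in> P. y' p \<noteq> y p}"
proof (rule finite_subset)
  show "finite ({p \<in> P. y p \<noteq> x\<^sub>0} \<union> {p \<in> P. y' p \<noteq> x\<^sub>0})"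
    using assms by (simp add: restricted_productD)
qed auto

lemma finite_changed_coordinates:
  assumes k: "k \<in> carrier \<Gamma>" and y: "y \<in> X"
  shows "finite {p \<in> P. \<beta> k p (y p) \<noteq> y p}"
proof (rule finite_subset)
  show "finite ({p \<in> P. y p \<noteq> x\<^sub>0} \<union> {p \<in> P. \<beta> k p x\<^sub>0 \<noteq> x\<^sub>0})"
    using k y by (simp add: restricted_productD finite_base_moved)
qed auto

text \<open>
  Take \<open>j\<close> so large that \<open>p\<close> is the only coordinate on its \<open>\<tau>\<^sup>j\<close>-orbit at which \<open>k\<close> may change \<open>y\<close>,
  and let \<open>y'\<close> be fixed by \<open>k\<tau>\<^sup>j\<close>. Away from \<open>p\<close>, the elements \<open>k\<tau>\<^sup>j\<close> and \<open>\<tau>\<^sup>j\<close> act alike on \<open>y\<close>,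
  so the uniqueness argument can be run on the two halves of the orbit separately: forward
  from \<open>p\<close>, and backward from the predecessor of \<open>p\<close>. It gives \<open>y' = y\<close> on both sides of the step into
  \<open>p\<close>, and this step, taken with \<open>k\<tau>\<^sup>j\<close> for \<open>y'\<close> and with \<open>\<tau>\<^sup>j\<close> for \<open>y\<close>, shows that \<open>k\<close> fixes \<open>y\<close>
  at \<open>p\<close>.
\<close>
lemma unmoving_element_fixes_infinite_orbits:
  assumes elliptic: "\<And>g. g \<in> carrier \<Gamma> \<Longrightarrow> \<exists>y\<in>X. fixes_over P y g"
    and \<tau>: "\<tau> \<in> carrier \<Gamma>" and y: "y \<in> X" "fixes_over P y \<tau>"
    and k: "k \<in> carrier \<Gamma>" "\<And>p. p \<in> P \<Longrightarrow> \<theta> k p = p"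
    and p: "p \<in> P" "infinite (cyclic_orbit \<tau> p)"
  shows "\<beta> k p (y p) = y p"
proof -
  have inv_P: "invariant P" by (simp add: invariant_def)
  have yX: "\<And>q. q \<in> P \<Longrightarrow> y q \<in> X\<^sub>0"
    using y by (simp add: restricted_productD)
  obtain j :: int where j: "j > 0"
    "\<And>m::int. m \<noteq> 0 \<Longrightarrow> \<theta> (\<tau> [^] (j * m)) p \<notin> {p \<in> P. \<beta> k p (y p) \<noteq> y p}"
    using exists_sparse_power[OF \<tau> p finite_changed_coordinates[OF k(1) y(1)]] by blast
  define q where "q m = \<theta> (\<tau> [^] (j * m)) p" for m :: int
  have qP: "q m \<in> P" for m
    using \<tau> p by (simp add: q_def)
  have q0: "q 0 = p" using p by (simp add: q_def)
  have kq: "\<beta> k (q m) (y (q m)) = y (q m)" if "m \<noteq> 0" for m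
    using j(2)[OF that] qP by (simp add: q_def)
  have inj_q: "inj q"
    using inj_int_pow_move[OF \<tau> p] j(1) unfolding q_def inj_def
    by (metis less_irrefl mult_left_cancel)
  define s where "s = \<tau> [^] j"
  have s: "s \<in> carrier \<Gamma>" using \<tau> by (simp add: s_def)
  have "subgroup {g \<in> carrier \<Gamma>. fixes_over P y g} \<Gamma>"
    using inv_P yX by (rule subgroup_fixes_over)
  then have "fixes_over P y s"
    using subgroup_int_pow_closed[of _ \<tau> j] \<tau> y unfolding s_def by blast
  moreover have sq: "\<theta> s (q m) = q (m + 1)" for m
    using move_int_pow_add[OF \<tau> p(1), of j "j * m"]
    by (simp add: s_def q_def algebra_simps)
  ultimately have ys: "\<beta> s (q m) (y (q m)) = y (q (m + 1))" for m
    using fixes_overD qP by metis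
  obtain y' where y': "y' \<in> X" "fixes_over P y' (k \<otimes> s)"
    using elliptic[of "k \<otimes> s"] k s by auto
  have y'X: "\<And>q. q \<in> P \<Longrightarrow> y' q \<in> X\<^sub>0"
    using y' by (simp add: restricted_productD)
  have y's: "y' (q (m + 1)) = \<beta> k (q (m + 1)) (\<beta> s (q m) (y' (q m)))" for m
    using fixes_overD[OF y'(2) qP[of m]] k s qP[of m] qP[of "m + 1"] y'X
    by (simp add: act_coord_mult move_mult sq)
  have agree_step: "y' (q (m + 1)) = y (q (m + 1)) \<longleftrightarrow> y' (q m) = y (q m)" if "m + 1 \<noteq> 0" for m
  proof -
    have "y' (q (m + 1)) = y (q (m + 1)) \<longleftrightarrow>
        \<beta> k (q (m + 1)) (\<beta> s (q m) (y' (q m))) = \<beta> k (q (m + 1)) (\<beta> s (q m) (y (q m)))"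
      using kq[OF that] by (simp add: y's ys)
    then show ?thesis
      using act_coord_inj k s qP yX y'X act_coord_closed by metis
  qed
  let ?D = "{p \<in> P. y' p \<noteq> y p}"
  have finD: "finite ?D"
    using y y' by (rule_tac finite_differing_coordinates) auto
  \<comment> \<open>The step into \<open>q 0 = p\<close> is the only one that agreement may fail to cross.\<close>
  have "q (int 0) \<notin> ?D"
  proof (rule finite_absorbing_set_avoids_start[OF _ finD])
    show "inj (\<lambda>n. q (int n))"
      using inj_q unfolding inj_def by (metis of_nat_eq_iff)
    show "q (int (Suc n)) \<in> ?D" if "q (int n) \<in> ?D" for n
      using that agree_step[of "int n"] qP by (auto simp: add.commute)
  qed
  moreover have "q (- 1 - int 0) \<notin> ?D"
  proof (rule finite_absorbing_set_avoids_start[OF _ finD])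
    show "inj (\<lambda>n. q (- 1 - int n))"
      by (rule injI) (drule injD[OF inj_q], simp)
    show "q (- 1 - int (Suc n)) \<in> ?D" if "q (- 1 - int n) \<in> ?D" for n
      using that agree_step[of "- 1 - int (Suc n)"] qP by auto
  qed
  ultimately have "y' p = y p" "y' (q (- 1)) = y (q (- 1))"
    using qP q0 p by auto
  then show ?thesis
    using y's[of "- 1"] ys[of "- 1"] q0 by simp
qed

text \<open>
  The function \<open>y'\<close> in the proof is \<open>\<sigma>\<inverse>y\<close>. It is fixed by \<open>\<tau>\<close> since \<open>y\<close> is fixed by the conjugate,
  and it differs from \<open>y\<close> in finitely many coordinates, so it equals \<open>y\<close> by uniqueness.
\<close>
lemma fixes_over_if_conjugate_fixes:
  assumes A: "invariant A" and \<tau>: "\<tau> \<in> carrier \<Gamma>" and \<sigma>: "\<sigma> \<in> carrier \<Gamma>"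
    and y: "y \<in> X" "fixes_over A y \<tau>" "fixes_over A y (\<sigma> \<otimes> \<tau> \<otimes> inv \<sigma>)"
    and inf: "\<And>p. p \<in> A \<Longrightarrow> infinite (cyclic_orbit \<tau> p)"
  shows "fixes_over A y \<sigma>"
proof -
  define y' where "y' q = \<beta> (inv \<sigma>) (\<theta> \<sigma> q) (y (\<theta> \<sigma> q))" for q
  have AP: "\<And>p. p \<in> A \<Longrightarrow> p \<in> P" using A by (rule invariant_subset)
  have yX: "\<And>q. q \<in> P \<Longrightarrow> y q \<in> X\<^sub>0"
    using y by (simp add: restricted_productD)
  have y'X: "\<And>q. q \<in> P \<Longrightarrow> y' q \<in> X\<^sub>0"
    using yX \<sigma> by (simp add: y'_def)
  have "\<beta> \<tau> q (y' q) = y' (\<theta> \<tau> q)" if q: "q \<in> A" for q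
  proof -
    define r where "r = \<theta> \<sigma> q"
    define \<rho> where "\<rho> = \<sigma> \<otimes> \<tau> \<otimes> inv \<sigma>"
    have r: "r \<in> A" "r \<in> P" "\<theta> (inv \<sigma>) r = q"
      using q A \<sigma> AP by (auto simp: r_def invariant_closed)
    have \<rho>: "\<rho> \<in> carrier \<Gamma>" "\<tau> \<otimes> inv \<sigma> = inv \<sigma> \<otimes> \<rho>" "\<theta> \<rho> r = \<theta> \<sigma> (\<theta> \<tau> q)"
      using \<sigma> \<tau> r AP[OF q] by (auto simp: \<rho>_def m_assoc move_mult simp flip: m_assoc[of "inv \<sigma>" \<sigma>])
    have "\<beta> \<tau> q (y' q) = \<beta> (\<tau> \<otimes> inv \<sigma>) r (y r)"
      using r \<sigma> \<tau> yX by (simp add: act_coord_mult y'_def flip: r_def)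
    also have "\<dots> = \<beta> (inv \<sigma>) (\<theta> \<rho> r) (\<beta> \<rho> r (y r))"
      unfolding \<rho>(2) using r \<sigma> \<rho>(1) yX by (simp add: act_coord_mult)
    also have "\<beta> \<rho> r (y r) = y (\<theta> \<rho> r)"
      using y(3) r(1) by (simp add: fixes_overD \<rho>_def)
    finally show ?thesis
      by (simp add: \<rho>(3) y'_def)
  qed
  then have "fixes_over A y' \<tau>"
    by (simp add: fixes_over_def)
  moreover have "finite {q \<in> A. y' q \<noteq> y q}"
  proof -
    let ?B = "{p \<in> P. y p \<noteq> x\<^sub>0} \<union> {p \<in> P. \<beta> (inv \<sigma>) p x\<^sub>0 \<noteq> x\<^sub>0}"
    have fin: "finite ?B" "finite {p \<in> P. y p \<noteq> x\<^sub>0}"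
      using \<sigma> y by (simp_all add: restricted_productD finite_base_moved)
    moreover have "finite (\<theta> \<sigma> -` ?B \<inter> P)"
      using fin inj_on_move[OF \<sigma>] by (intro finite_vimage_IntI)
    moreover have "{q \<in> A. y' q \<noteq> y q} \<subseteq> {p \<in> P. y p \<noteq> x\<^sub>0} \<union> (\<theta> \<sigma> -` ?B \<inter> P)"
      using AP \<sigma> by (auto simp: y'_def)
    ultimately show ?thesis
      using finite_subset by blast
  qed
  ultimately have eq: "y' p = y p" if "p \<in> A" for p
    using fixed_point_unique_on_infinite_orbit[OF \<tau> A that inf[OF that], of y y'] y yX y'X AP
    by blast
  show ?thesis
    unfolding fixes_over_def
  proof
    fix p assume p: "p \<in> A"
    then have "\<beta> \<sigma> p (y p) = \<beta> \<sigma> p (\<beta> (inv \<sigma>) (\<theta> \<sigma> p) (y (\<theta> \<sigma> p)))"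
      using eq by (simp add: y'_def)
    also have "\<dots> = y (\<theta> \<sigma> p)"
      using act_coord_inv[of "inv \<sigma>" "\<theta> \<sigma> p" "y (\<theta> \<sigma> p)"] \<sigma> AP[OF p] yX by simp
    finally show "\<beta> \<sigma> p (y p) = y (\<theta> \<sigma> p)" .
  qed
qed

text \<open>
  This serves twice: for \<open>f = \<theta> h\<close> with \<open>h\<close> commuting with \<open>g = \<tau>\<close>, and for \<open>f\<close> conjugating one
  element to another.
\<close>
lemma image_cyclic_orbit:
  assumes g: "g \<in> carrier \<Gamma>" and h: "h \<in> carrier \<Gamma>" and p: "p \<in> P"
    and f: "\<And>q. q \<in> P \<Longrightarrow> f q \<in> P" "\<And>q. q \<in> P \<Longrightarrow> f (\<theta> g q) = \<theta> h (f q)"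
  shows "f ` cyclic_orbit g p = cyclic_orbit h (f p)"
proof -
  have f_inv: "f (\<theta> (inv g) q) = \<theta> (inv h) (f q)" if "q \<in> P" for q
    using f(2)[of "\<theta> (inv g) q"] f(1) g h that
    by (metis inv_closed move_closed move_inv_move move_move_inv)
  have "f (\<theta> (g [^] k) p) = \<theta> (h [^] k) (f p)" for k :: int
  proof (induction k rule: int_induct[where k = 0])
    case base
    show ?case using f p by simp
  next
    case (step1 i)
    then show ?case
      using move_int_pow_add[OF g p, of 1 i] move_int_pow_add[OF h f(1)[OF p], of 1 i] f g h p
      by (simp add: add.commute)
  next
    case (step2 i)
    then show ?case
      using move_int_pow_add[OF g p, of "-1" i] move_int_pow_add[OF h f(1)[OF p], of "-1" i]
        f_inv g h p by (simp add: int_pow_neg)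
  qed
  then show ?thesis by (simp add: image_image)
qed

text \<open>
  Suppose that the \<open>\<tau>\<close>-orbit of \<open>p\<close> is finite. The set \<open>?F\<close> of all such elements is finite and
  \<open>N\<close>-invariant, so it contains the orbit of \<open>p\<close> under any \<open>h = g\<inverse>\<tau>g\<close>, and \<open>\<theta> g\<close> maps that
  orbit onto the \<open>\<tau>\<close>-orbit of \<open>\<theta> g p\<close>. Hence the whole \<open>\<Gamma>\<close>-orbit of \<open>p\<close> lies in \<open>?F\<close>.
\<close>
lemma infinite_cyclic_orbit_if_infinite_orbit:
  assumes N: "N \<lhd> \<Gamma>"
    and comm: "\<And>g h p. \<lbrakk>g \<in> N; h \<in> N; p \<in> P\<rbrakk> \<Longrightarrow> \<theta> g (\<theta> h p) = \<theta> h (\<theta> g p)"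
    and \<tau>: "\<tau> \<in> N" and fin: "finite {p \<in> P. finite (cyclic_orbit \<tau> p)}"
    and p: "p \<in> P" "infinite (orbit \<Gamma> \<theta> p)"
  shows "infinite (cyclic_orbit \<tau> p)"
proof
  interpret N: normal N \<Gamma> by (rule N)
  let ?F = "{p \<in> P. finite (cyclic_orbit \<tau> p)}"
  assume "finite (cyclic_orbit \<tau> p)"
  then have pF: "p \<in> ?F" using p by simp
  have \<tau>\<Gamma>: "\<tau> \<in> carrier \<Gamma>" using \<tau> by (rule N.mem_carrier)
  \<comment> \<open>\<open>N\<close> commutes with \<open>\<tau>\<close> on \<open>P\<close>, so it permutes the \<open>\<tau>\<close>-orbits.\<close>
  have N_F: "\<theta> h q \<in> ?F" if "h \<in> N" "q \<in> ?F" for h q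
    using that comm \<tau> \<tau>\<Gamma> N.mem_carrier
    by (auto simp flip: image_cyclic_orbit[of \<tau> \<tau> q "\<theta> h"])
  have "orbit \<Gamma> \<theta> p \<subseteq> ?F"
  proof
    fix q assume "q \<in> orbit \<Gamma> \<theta> p"
    then obtain g where g: "g \<in> carrier \<Gamma>" "q = \<theta> g p" by (auto simp: orbit_def)
    define h where "h = inv g \<otimes> \<tau> \<otimes> g"
    have h: "h \<in> carrier \<Gamma>" "h \<in> N" "g \<otimes> h = \<tau> \<otimes> g"
      using N.inv_op_closed1[OF g(1) \<tau>] g \<tau>\<Gamma>
      by (auto simp: h_def simp flip: m_assoc)
    have "h [^] i \<in> N" for i :: int
      using h N.subgroup_axioms by (intro subgroup_int_pow_closed)
    then have "cyclic_orbit h p \<subseteq> ?F"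
      using N_F pF by blast
    then have "finite (\<theta> g ` cyclic_orbit h p)"
      using fin finite_subset by blast
    moreover have "\<theta> g ` cyclic_orbit h p = cyclic_orbit \<tau> (\<theta> g p)"
      using g h \<tau>\<Gamma> p by (intro image_cyclic_orbit) (simp_all flip: move_mult)
    ultimately show "q \<in> ?F"
      using g p by simp
  qed
  with fin p show False
    using finite_subset by blast
qed

lemma orbit_move:
  assumes "g \<in> carrier \<Gamma>" "p \<in> P"
  shows "orbit \<Gamma> \<theta> (\<theta> g p) = orbit \<Gamma> \<theta> p"
proof (intro equalityI subsetI)
  fix q assume "q \<in> orbit \<Gamma> \<theta> (\<theta> g p)"
  then show "q \<in> orbit \<Gamma> \<theta> p"
    using assms by (auto simp: orbit_def simp flip: move_mult)
next
  fix q assume "q \<in> orbit \<Gamma> \<theta> p"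
  then obtain h where h: "h \<in> carrier \<Gamma>" "q = \<theta> h p" by (auto simp: orbit_def)
  then have "q = \<theta> (h \<otimes> inv g) (\<theta> g p)"
    using assms by (simp add: move_mult)
  then show "q \<in> orbit \<Gamma> \<theta> (\<theta> g p)"
    using assms h by (auto simp: orbit_def)
qed

lemma invariant_orbits:
  "invariant {p \<in> P. Q (orbit \<Gamma> \<theta> p)}"
  by (auto simp: invariant_def orbit_move)

lemma invariant_orbit:
  "p \<in> P \<Longrightarrow> invariant (orbit \<Gamma> \<theta> p)"
  by (auto simp: invariant_def orbit_def simp flip: move_mult)

lemma self_mem_orbit: "p \<in> P \<Longrightarrow> p \<in> orbit \<Gamma> \<theta> p"
  by (auto simp: orbit_def intro!: exI[of _ \<one>])

text \<open>
  Any \<open>\<tau>\<close>-fixed point \<open>y \<in> X\<close> has the required restriction. The conjugation lemma is applied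
  first to \<open>\<sigma> \<in> N\<close>, where \<open>\<sigma>\<tau>\<sigma>\<inverse>\<tau>\<inverse>\<close> acts trivially on \<open>P\<close>, and then to all \<open>\<sigma> \<in> \<Gamma>\<close>, where
  \<open>\<sigma>\<tau>\<sigma>\<inverse> \<in> N\<close> is known to fix \<open>y\<close>.
\<close>
lemma fixed_point_over_infinite_orbits:
  assumes elliptic: "\<And>g. g \<in> carrier \<Gamma> \<Longrightarrow> \<exists>y\<in>X. fixes_over P y g"
    and N: "N \<lhd> \<Gamma>"
    and comm: "\<And>g h p. \<lbrakk>g \<in> N; h \<in> N; p \<in> P\<rbrakk> \<Longrightarrow> \<theta> g (\<theta> h p) = \<theta> h (\<theta> g p)"
    and \<tau>: "\<tau> \<in> N" and fin: "finite {p \<in> P. finite (cyclic_orbit \<tau> p)}"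
  obtains y where "y \<in> X"
    "\<And>g. g \<in> carrier \<Gamma> \<Longrightarrow> fixes_over {p \<in> P. infinite (orbit \<Gamma> \<theta> p)} y g"
proof -
  interpret N: normal N \<Gamma> by (rule N)
  let ?A = "{p \<in> P. infinite (orbit \<Gamma> \<theta> p)}"
  have A: "invariant ?A" by (rule invariant_orbits)
  have inf: "infinite (cyclic_orbit \<tau> p)" if "p \<in> ?A" for p
    using that infinite_cyclic_orbit_if_infinite_orbit[OF N comm \<tau> fin] by blast
  have \<tau>\<Gamma>: "\<tau> \<in> carrier \<Gamma>" using \<tau> by (rule N.mem_carrier)
  obtain y where y: "y \<in> X" "fixes_over P y \<tau>"
    using elliptic[OF \<tau>\<Gamma>] by blast
  have y\<tau>: "fixes_over ?A y \<tau>" using y(2) by (simp add: fixes_over_def)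
  have sub: "subgroup {g \<in> carrier \<Gamma>. fixes_over ?A y g} \<Gamma>"
    using A y by (intro subgroup_fixes_over) (auto simp: restricted_productD)
  have fix_N: "fixes_over ?A y \<sigma>" if \<sigma>: "\<sigma> \<in> N" for \<sigma>
  proof -
    have \<sigma>\<Gamma>: "\<sigma> \<in> carrier \<Gamma>" using \<sigma> by (rule N.mem_carrier)
    define k where "k = \<sigma> \<otimes> \<tau> \<otimes> inv \<sigma> \<otimes> inv \<tau>"
    have k: "k \<in> carrier \<Gamma>" "k \<otimes> \<tau> = \<sigma> \<otimes> \<tau> \<otimes> inv \<sigma>"
      using \<sigma>\<Gamma> \<tau>\<Gamma> by (auto simp: k_def m_assoc)
    have unmoving: "\<theta> k p = p" if "p \<in> P" for p
      using comm[OF \<sigma> \<tau>, of "\<theta> (inv \<sigma>) (\<theta> (inv \<tau>) p)"] \<sigma>\<Gamma> \<tau>\<Gamma> that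
      by (simp add: k_def move_mult)
    then have "fixes_over ?A y k"
      using unmoving_element_fixes_infinite_orbits[OF elliptic \<tau>\<Gamma> y k(1)] inf
      by (auto simp: fixes_over_def)
    then have "fixes_over ?A y (\<sigma> \<otimes> \<tau> \<otimes> inv \<sigma>)"
      using subgroup.m_closed[OF sub, of k \<tau>] y\<tau> \<tau>\<Gamma> k by simp
    then show ?thesis
      using fixes_over_if_conjugate_fixes[OF A \<tau>\<Gamma> \<sigma>\<Gamma> y(1) y\<tau> _ inf] by blast
  qed
  have "fixes_over ?A y g" if "g \<in> carrier \<Gamma>" for g
    using fixes_over_if_conjugate_fixes[OF A \<tau>\<Gamma> that y(1) y\<tau> _ inf] fix_N
      N.inv_op_closed2[OF that \<tau>] by blast
  with y that show thesis by blast
qed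

section \<open>Finite orbits\<close>

lemma base_fixed_over_undisturbed_orbit:
  assumes p: "p \<in> P" and S: "S \<subseteq> carrier \<Gamma>" "generate \<Gamma> S = carrier \<Gamma>"
    and base: "\<And>s q. \<lbrakk>s \<in> S; q \<in> orbit \<Gamma> \<theta> p\<rbrakk> \<Longrightarrow> \<beta> s q x\<^sub>0 = x\<^sub>0"
    and g: "g \<in> carrier \<Gamma>"
  shows "fixes_over (orbit \<Gamma> \<theta> p) (\<lambda>_. x\<^sub>0) g"
proof -
  have "subgroup {g \<in> carrier \<Gamma>. fixes_over (orbit \<Gamma> \<theta> p) (\<lambda>_. x\<^sub>0) g} \<Gamma>"
    using invariant_orbit[OF p] by (rule subgroup_fixes_over) simp
  then have "generate \<Gamma> S \<subseteq> {g \<in> carrier \<Gamma>. fixes_over (orbit \<Gamma> \<theta> p) (\<lambda>_. x\<^sub>0) g}"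
    using S base by (intro generate_subgroup_incl) (auto simp: fixes_over_def)
  with S g show ?thesis by blast
qed

definition local_group :: "'p \<Rightarrow> 'g set" where
  "local_group p = (\<lambda>g. \<alpha> g p) ` {g \<in> carrier \<Gamma>. \<theta> g p = p}"

lemma subgroup_local_group:
  assumes p: "p \<in> P" shows "subgroup (local_group p) G\<^sub>0"
proof -
  let ?St = "{g \<in> carrier \<Gamma>. \<theta> g p = p}"
  interpret St: group_hom "\<Gamma>\<lparr>carrier := ?St\<rparr>" G\<^sub>0 "\<lambda>g. \<alpha> g p"
    using p subgroup_move_stabilizer[OF p] subgroup_imp_group
    by (auto intro!: group_hom.intro group_hom_axioms.intro homI simp: coord_mult)
  show ?thesis
    using St.img_is_subgroup by (simp add: local_group_def)
qed

text \<open>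
  Schreier's argument, carried out directly for the cocycle. With a transversal \<open>r\<close> of the orbit,
  \<open>c g q\<close> is the loop at \<open>p\<close> that goes to \<open>q\<close>, follows \<open>g\<close>, and returns. Loops multiply as
  \<open>c (g \<otimes> h) q = c g (\<theta> h q) \<otimes> c h q\<close>, so those for the generators \<open>s \<in> S\<close> and \<open>q\<close> in the orbit
  generate all of them, and if \<open>g\<close> stabilizes \<open>p\<close> then \<open>c g p = g\<close>, as the transversal
  has \<open>r p = \<one>\<close>.
\<close>
lemma finitely_generated_local_group:
  assumes p: "p \<in> P" "finite (orbit \<Gamma> \<theta> p)" and \<Gamma>: "finitely_generated \<Gamma>"
  shows "finitely_generated (G\<^sub>0\<lparr>carrier := local_group p\<rparr>)"
proof -
  obtain S where S: "finite S" "S \<subseteq> carrier \<Gamma>" "generate \<Gamma> S = carrier \<Gamma>"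
    using \<Gamma> by (auto simp: finitely_generated_def)
  let ?O = "orbit \<Gamma> \<theta> p"
  let ?K = "local_group p"
  have O: "invariant ?O" using p(1) by (rule invariant_orbit)
  have OP: "\<And>q. q \<in> ?O \<Longrightarrow> q \<in> P" using O by (rule invariant_subset)
  have "\<exists>r\<in>carrier \<Gamma>. \<theta> r p = q \<and> (q = p \<longrightarrow> r = \<one>)" if "q \<in> ?O" for q
    using that p by (cases "q = p") (auto simp: orbit_def)
  then obtain r where r: "\<And>q. q \<in> ?O \<Longrightarrow> r q \<in> carrier \<Gamma>" "\<And>q. q \<in> ?O \<Longrightarrow> \<theta> (r q) p = q"
    and rp: "r p = \<one>"
    using self_mem_orbit[OF p(1)] by metis
  define c where "c g q = inv (r (\<theta> g q)) \<otimes> g \<otimes> r q" for g q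
  define u where "u g q = \<alpha> (c g q) p" for g q
  have c: "c g q \<in> carrier \<Gamma>" "\<theta> (c g q) p = p" if "g \<in> carrier \<Gamma>" "q \<in> ?O" for g q
  proof -
    have q': "\<theta> g q \<in> ?O" using O that by (rule invariant_closed)
    show "c g q \<in> carrier \<Gamma>"
      using that r q' by (simp add: c_def)
    show "\<theta> (c g q) p = p"
      using that r q' p OP move_inv_move[of "r (\<theta> g q)" p] by (simp add: c_def move_mult)
  qed
  have c_mult: "c (g \<otimes> h) q = c g (\<theta> h q) \<otimes> c h q"
    if gh: "g \<in> carrier \<Gamma>" "h \<in> carrier \<Gamma>" and q: "q \<in> ?O" for g h q
  proof -
    have "\<theta> h q \<in> ?O" "\<theta> g (\<theta> h q) \<in> ?O" using O gh q by (auto intro: invariant_closed)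
    then have "r q \<in> carrier \<Gamma>" "r (\<theta> h q) \<in> carrier \<Gamma>" "r (\<theta> g (\<theta> h q)) \<in> carrier \<Gamma>"
      using r q by auto
    moreover have "a \<otimes> (inv a \<otimes> b) = b" if "a \<in> carrier \<Gamma>" "b \<in> carrier \<Gamma>" for a b
      using that by (simp flip: m_assoc)
    ultimately show ?thesis
      using gh OP[OF q] by (simp add: c_def move_mult m_assoc)
  qed
  have u_mult: "u (g \<otimes> h) q = u g (\<theta> h q) \<otimes>\<^bsub>G\<^sub>0\<^esub> u h q"
    if "g \<in> carrier \<Gamma>" "h \<in> carrier \<Gamma>" "q \<in> ?O" for g h q
    using that c p invariant_closed[OF O that(2,3)] by (simp add: u_def c_mult coord_mult)
  have u_K: "u g q \<in> ?K" if "g \<in> carrier \<Gamma>" "q \<in> ?O" for g q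
    using c that by (auto simp: u_def local_group_def)
  have K_G: "?K \<subseteq> carrier G\<^sub>0"
    using subgroup_local_group[OF p(1)] by (rule subgroup.subset)
  define T where "T = (\<lambda>(s, q). u s q) ` (S \<times> ?O)"
  have T: "finite T" "T \<subseteq> ?K"
    using S p u_K by (auto simp: T_def)
  have T_G: "T \<subseteq> carrier G\<^sub>0" using T K_G by blast
  have "\<forall>q\<in>?O. u g q \<in> generate G\<^sub>0 T" if "g \<in> generate \<Gamma> S" for g
    using that
  proof (induction rule: generate.induct)
    case one
    have "u \<one> q = \<one>\<^bsub>G\<^sub>0\<^esub>" if "q \<in> ?O" for q
      using r[OF that] OP[OF that] p by (simp add: u_def c_def)
    then show ?case by (simp add: generate.one)
  next
    case (incl s)
    then show ?case by (auto simp: T_def intro!: generate.incl)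
  next
    case (inv s)
    show ?case
    proof
      fix q assume q: "q \<in> ?O"
      have s: "s \<in> carrier \<Gamma>" using S inv by blast
      have q': "\<theta> (inv s) q \<in> ?O" using O q s by (auto intro: invariant_closed)
      have "u s (\<theta> (inv s) q) \<otimes>\<^bsub>G\<^sub>0\<^esub> u (inv s) q = u (s \<otimes> inv s) q"
        using q s by (intro u_mult[symmetric]) auto
      also have "\<dots> = \<one>\<^bsub>G\<^sub>0\<^esub>"
        using r[OF q] OP[OF q] p s by (simp add: u_def c_def)
      finally have "u (inv s) q = inv\<^bsub>G\<^sub>0\<^esub> (u s (\<theta> (inv s) q))"
        using u_K q q' s K_G by (metis G\<^sub>0.inv_equality G\<^sub>0.inv_inv inv_closed subsetD G\<^sub>0.inv_comm)
      moreover have "u s (\<theta> (inv s) q) \<in> T"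
        using inv q' by (auto simp: T_def)
      ultimately show "u (inv s) q \<in> generate G\<^sub>0 T"
        by (simp add: generate.inv)
    qed
  next
    case (eng g h)
    then have "g \<in> carrier \<Gamma>" "h \<in> carrier \<Gamma>" using S by auto
    then show ?case
      using eng.IH O by (auto simp: u_mult invariant_closed intro!: generate.eng)
  qed
  moreover have "\<alpha> g p = u g p" if "g \<in> carrier \<Gamma>" "\<theta> g p = p" for g
    using that rp p by (simp add: u_def c_def)
  ultimately have "?K \<subseteq> generate G\<^sub>0 T"
    using S(3) self_mem_orbit[OF p(1)] by (auto simp: local_group_def)
  moreover have "generate G\<^sub>0 T \<subseteq> ?K"
    using T(2) subgroup_local_group[OF p(1)] by (rule G\<^sub>0.generate_subgroup_incl)
  moreover have "generate (G\<^sub>0\<lparr>carrier := ?K\<rparr>) T = generate G\<^sub>0 T"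
    using T(2) subgroup_local_group[OF p(1)] by (rule G\<^sub>0.generate_consistent)
  ultimately show ?thesis
    using T by (auto simp: finitely_generated_def)
qed

text \<open>
  The value \<open>w q = \<beta> g p x\<close> does not depend on the choice of \<open>g\<close> with \<open>\<theta> g p = q\<close>, because two choices
  differ by an element that stabilizes \<open>p\<close> and hence fixes \<open>x\<close>.
\<close>
lemma extend_local_fixed_point:
  assumes p: "p \<in> P" and x: "x \<in> X\<^sub>0" "\<And>a. a \<in> local_group p \<Longrightarrow> \<phi> a x = x"
  obtains w where "\<And>q. q \<in> orbit \<Gamma> \<theta> p \<Longrightarrow> w q \<in> X\<^sub>0"
    "\<And>g. g \<in> carrier \<Gamma> \<Longrightarrow> fixes_over (orbit \<Gamma> \<theta> p) w g"
proof -
  let ?O = "orbit \<Gamma> \<theta> p"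
  have "\<exists>r\<in>carrier \<Gamma>. \<theta> r p = q" if "q \<in> ?O" for q
    using that by (auto simp: orbit_def)
  then obtain r where r: "\<And>q. q \<in> ?O \<Longrightarrow> r q \<in> carrier \<Gamma>" "\<And>q. q \<in> ?O \<Longrightarrow> \<theta> (r q) p = q"
    by metis
  define w where "w q = \<beta> (r q) p x" for q
  have w: "\<beta> g p x = w (\<theta> g p)" if g: "g \<in> carrier \<Gamma>" for g
  proof -
    define q where "q = \<theta> g p"
    have q: "q \<in> ?O" using g by (auto simp: q_def orbit_def)
    define h where "h = inv (r q) \<otimes> g"
    have h: "h \<in> carrier \<Gamma>" "r q \<otimes> h = g"
      using g r q by (auto simp: h_def inv_solve_left simp flip: m_assoc)
    have hp: "\<theta> h p = p"
      using g p r[OF q] move_inv_move[of "r q" p] by (simp add: h_def move_mult flip: q_def)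
    have "\<beta> h p x = x"
      using x h hp by (auto simp: local_group_def)
    then have "\<beta> (r q \<otimes> h) p x = \<beta> (r q) p x"
      using act_coord_mult[OF r(1)[OF q] h(1) p x(1)] hp by simp
    then show ?thesis
      using h(2) by (simp add: w_def flip: q_def)
  qed
  show thesis
  proof
    show "w q \<in> X\<^sub>0" if "q \<in> ?O" for q
      using r[OF that] p x by (simp add: w_def)
    show "fixes_over ?O w g" if g: "g \<in> carrier \<Gamma>" for g
      unfolding fixes_over_def
    proof
      fix q assume "q \<in> ?O"
      then obtain h where h: "h \<in> carrier \<Gamma>" "q = \<theta> h p" by (auto simp: orbit_def)
      have "\<beta> g q (w q) = \<beta> (g \<otimes> h) p x"
        using g h p x by (simp add: act_coord_mult flip: w)
      also have "\<dots> = w (\<theta> g q)"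
        using g h p w[of "g \<otimes> h"] by (simp add: move_mult)
      finally show "\<beta> g q (w q) = w (\<theta> g q)" .
    qed
  qed
qed

lemma fixed_point_over_finite_orbit:
  assumes decent: "decent_action G\<^sub>0 X\<^sub>0 \<phi>" and \<Gamma>: "finitely_generated \<Gamma>"
    and elliptic: "\<And>g. g \<in> carrier \<Gamma> \<Longrightarrow> \<exists>y\<in>X. fixes_over P y g"
    and p: "p \<in> P" "finite (orbit \<Gamma> \<theta> p)"
  obtains w where "\<And>q. q \<in> orbit \<Gamma> \<theta> p \<Longrightarrow> w q \<in> X\<^sub>0"
    "\<And>g. g \<in> carrier \<Gamma> \<Longrightarrow> fixes_over (orbit \<Gamma> \<theta> p) w g"
proof -
  interpret decent_action G\<^sub>0 X\<^sub>0 \<phi> by (rule decent)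
  let ?K = "local_group p"
  have "purely_elliptic (G\<^sub>0\<lparr>carrier := ?K\<rparr>) X\<^sub>0 \<phi>"
    unfolding purely_elliptic_def
  proof
    fix a assume "a \<in> carrier (G\<^sub>0\<lparr>carrier := ?K\<rparr>)"
    then obtain g where g: "g \<in> carrier \<Gamma>" "\<theta> g p = p" "a = \<alpha> g p"
      by (auto simp: local_group_def)
    then obtain y where y: "y \<in> X" "fixes_over P y g"
      using elliptic by blast
    have "y p \<in> X\<^sub>0" "\<phi> a (y p) = y p"
      using restricted_productD(1)[OF y(1) p(1)] fixes_overD[OF y(2) p(1)] g by auto
    then show "\<exists>x\<in>X\<^sub>0. \<phi> a x = x" by blast
  qed
  then have "has_global_fixed_point (G\<^sub>0\<lparr>carrier := ?K\<rparr>) X\<^sub>0 \<phi>"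
    using subgroup_local_group[OF p(1)] finitely_generated_local_group[OF p \<Gamma>]
    by (intro purely_elliptic_imp_fixed_point)
  then obtain x where x: "x \<in> X\<^sub>0" "\<And>a. a \<in> ?K \<Longrightarrow> \<phi> a x = x"
    by (auto simp: has_global_fixed_point_def)
  show thesis
    by (rule extend_local_fixed_point[OF p(1) x], assumption, rule that)
qed

text \<open>
  The two kinds of orbits are glued together. The set \<open>F\<close> of coordinates at which a generator moves
  \<open>x\<^sub>0\<close> is finite because \<open>\<Gamma>\<close> is finitely generated.
\<close>
theorem global_fixed_point:
  assumes decent: "decent_action G\<^sub>0 X\<^sub>0 \<phi>" and \<Gamma>: "finitely_generated \<Gamma>"
    and elliptic: "\<And>g. g \<in> carrier \<Gamma> \<Longrightarrow> \<exists>y\<in>X. fixes_over P y g"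
    and N: "N \<lhd> \<Gamma>"
    and comm: "\<And>g h p. \<lbrakk>g \<in> N; h \<in> N; p \<in> P\<rbrakk> \<Longrightarrow> \<theta> g (\<theta> h p) = \<theta> h (\<theta> g p)"
    and \<tau>: "\<tau> \<in> N" and fin: "finite {p \<in> P. finite (cyclic_orbit \<tau> p)}"
  shows "\<exists>z\<in>X. \<forall>g\<in>carrier \<Gamma>. fixes_over P z g"
proof -
  let ?O = "\<lambda>p. orbit \<Gamma> \<theta> p"
  obtain S where S: "finite S" "S \<subseteq> carrier \<Gamma>" "generate \<Gamma> S = carrier \<Gamma>"
    using \<Gamma> by (auto simp: finitely_generated_def)
  define F where "F = (\<Union>s\<in>S. {p \<in> P. \<beta> s p x\<^sub>0 \<noteq> x\<^sub>0})"
  have F: "finite F"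
    using S finite_base_moved by (auto simp: F_def)
  obtain y where y: "y \<in> X" "\<And>g. g \<in> carrier \<Gamma> \<Longrightarrow> fixes_over {p \<in> P. infinite (?O p)} y g"
    using fixed_point_over_infinite_orbits[OF elliptic N comm \<tau> fin] by blast
  \<comment> \<open>One function per orbit, chosen to be \<open>x\<^sub>0\<close> on the orbits that the generators leave
    undisturbed, so that the glued point differs from \<open>x\<^sub>0\<close> on finitely many finite orbits only.\<close>
  let ?good = "\<lambda>B w. (\<forall>q\<in>B. w q \<in> X\<^sub>0) \<and> (\<forall>g\<in>carrier \<Gamma>. fixes_over B w g) \<and>
      (B \<inter> F = {} \<longrightarrow> w = (\<lambda>_. x\<^sub>0))"
  have ex_good: "\<exists>w. ?good B w" if B: "B \<in> ?O ` P" "finite B" for B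
  proof (cases "B \<inter> F = {}")
    case True
    obtain p where p: "p \<in> P" "B = ?O p" using B by blast
    have "\<beta> s q x\<^sub>0 = x\<^sub>0" if "s \<in> S" "q \<in> ?O p" for s q
      using that True p(2) invariant_subset[OF invariant_orbit[OF p(1)] that(2)]
      unfolding F_def by blast
    then have "fixes_over B (\<lambda>_. x\<^sub>0) g" if "g \<in> carrier \<Gamma>" for g
      using base_fixed_over_undisturbed_orbit[OF p(1) S(2,3)] that p by blast
    then show ?thesis by (intro exI[of _ "\<lambda>_. x\<^sub>0"]) auto
  next
    case False
    obtain p where p: "p \<in> P" "B = ?O p" using B by blast
    obtain w where "\<And>q. q \<in> B \<Longrightarrow> w q \<in> X\<^sub>0" "\<And>g. g \<in> carrier \<Gamma> \<Longrightarrow> fixes_over B w g"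
      using fixed_point_over_finite_orbit[OF decent \<Gamma> elliptic p(1)] B(2) p(2) by blast
    with False show ?thesis by blast
  qed
  define w where "w B = (SOME w. ?good B w)" for B
  have good: "?good B (w B)" if "B \<in> ?O ` P" "finite B" for B
    unfolding w_def using ex_good[OF that] by (rule someI_ex)
  have w:
    "\<And>B q. \<lbrakk>B \<in> ?O ` P; finite B; q \<in> B\<rbrakk> \<Longrightarrow> w B q \<in> X\<^sub>0"
    "\<And>B g. \<lbrakk>B \<in> ?O ` P; finite B; g \<in> carrier \<Gamma>\<rbrakk> \<Longrightarrow> fixes_over B (w B) g"
    "\<And>B. \<lbrakk>B \<in> ?O ` P; finite B; B \<inter> F = {}\<rbrakk> \<Longrightarrow> w B = (\<lambda>_. x\<^sub>0)"
    using good by simp_all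
  define z where "z = (\<lambda>p\<in>P. if finite (?O p) then w (?O p) p else y p)"
  have "z \<in> X"
  proof -
    have "z p \<in> X\<^sub>0" if "p \<in> P" for p
      using that w(1)[of "?O p" p] self_mem_orbit[OF that] restricted_productD(1)[OF y(1) that]
      by (simp add: z_def)
    then have "z \<in> P \<rightarrow>\<^sub>E X\<^sub>0"
      by (auto simp: z_def)
    moreover have "{p \<in> P. z p \<noteq> x\<^sub>0} \<subseteq>
        {p \<in> P. y p \<noteq> x\<^sub>0} \<union> (\<Union>f\<in>{f\<in>F. finite (?O f)}. ?O f)"
    proof
      fix p assume p: "p \<in> {p \<in> P. z p \<noteq> x\<^sub>0}"
      show "p \<in> {p \<in> P. y p \<noteq> x\<^sub>0} \<union> (\<Union>f\<in>{f\<in>F. finite (?O f)}. ?O f)"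
      proof (cases "finite (?O p)")
        case True
        then have "w (?O p) \<noteq> (\<lambda>_. x\<^sub>0)" using p by (auto simp: z_def)
        then obtain f where f: "f \<in> ?O p" "f \<in> F"
          using w(3)[of "?O p"] True p by blast
        then have "?O f = ?O p"
          using p orbit_move by (auto simp: orbit_def[of _ _ p])
        then show ?thesis
          using f True p self_mem_orbit by auto
      qed (use p in \<open>auto simp: z_def\<close>)
    qed
    then have "finite {p \<in> P. z p \<noteq> x\<^sub>0}"
      by (rule finite_subset) (use F restricted_productD(2)[OF y(1)] in auto)
    ultimately show ?thesis by (simp add: restricted_product_def)
  qed
  moreover have "fixes_over P z g" if g: "g \<in> carrier \<Gamma>" for g
    unfolding fixes_over_def
  proof
    fix p assume p: "p \<in> P"
    then show "\<beta> g p (z p) = z (\<theta> g p)"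
      using fixes_overD[OF y(2)[OF g], of p] fixes_overD[OF w(2)[OF _ _ g], of "?O p" p] g
        self_mem_orbit[OF p] by (simp add: z_def orbit_move)
  qed
  ultimately show ?thesis by blast
qed

end

section \<open>The wreath product\<close>

text \<open>The cosets of the trivial subgroup are singletons, which multiply as their elements do.\<close>
lemma abelian_if_quotient_by_trivial_abelian:
  assumes "group H" "N \<subseteq> carrier H" "comm_group ((H\<lparr>carrier := N\<rparr>) Mod {\<one>\<^bsub>H\<^esub>})" "a \<in> N" "b \<in> N"
  shows "a \<otimes>\<^bsub>H\<^esub> b = b \<otimes>\<^bsub>H\<^esub> a"
proof -
  interpret H: group H by fact
  interpret Q: comm_group "(H\<lparr>carrier := N\<rparr>) Mod {\<one>\<^bsub>H\<^esub>}" by fact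
  have "{c} \<in> carrier ((H\<lparr>carrier := N\<rparr>) Mod {\<one>\<^bsub>H\<^esub>})" if "c \<in> N" for c
    using that assms(2) by (force simp: FactGroup_def RCOSETS_def r_coset_def)
  then show ?thesis
    using Q.m_comm[of "{a}" "{b}"] assms by (simp add: FactGroup_def set_mult_def)
qed

context wreath_data
begin

text \<open>
  The finiteness condition is the preservation of the restricted product, tested on the constant
  function \<open>x\<^sub>0\<close>.
\<close>
lemma coordinate_action_preserving_subgroup:
  assumes \<Gamma>: "subgroup \<Gamma> (preserving_wreath_product G\<^sub>0 X\<^sub>0 \<phi> x\<^sub>0 H P \<psi>)" and x\<^sub>0: "x\<^sub>0 \<in> X\<^sub>0"
  shows "coordinate_action
    ((preserving_wreath_product G\<^sub>0 X\<^sub>0 \<phi> x\<^sub>0 H P \<psi>)\<lparr>carrier := \<Gamma>\<rparr>) G\<^sub>0 X\<^sub>0 \<phi> P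
    (\<lambda>\<gamma>. \<psi> (snd \<gamma>)) (\<lambda>\<gamma> p. fst \<gamma> (\<psi> (snd \<gamma>) p)) x\<^sub>0"
proof -
  let ?G = "preserving_wreath_product G\<^sub>0 X\<^sub>0 \<phi> x\<^sub>0 H P \<psi>"
  interpret W: group W by (rule group_wreath_product)
  have "group ?G"
    using W.subgroup_imp_group[OF subgroup_preserving]
    by (simp add: preserving_wreath_product_def)
  then have grp: "group (?G\<lparr>carrier := \<Gamma>\<rparr>)"
    using \<Gamma> by (rule group.subgroup_imp_group)
  have sub: "\<gamma> \<in> carrier W" "act \<gamma> ` restricted_product P X\<^sub>0 x\<^sub>0 = restricted_product P X\<^sub>0 x\<^sub>0"
    if "\<gamma> \<in> \<Gamma>" for \<gamma>
    using subgroup.subset[OF \<Gamma>] that by (auto simp: preserving_wreath_product_def)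
  have comp: "fst \<gamma> \<in> P \<rightarrow>\<^sub>E carrier G\<^sub>0" "snd \<gamma> \<in> carrier H" if "\<gamma> \<in> \<Gamma>" for \<gamma>
    using sub(1)[OF that] by (auto simp: wreath_product_def)
  have psi_inv: "\<psi> (inv\<^bsub>H\<^esub> h) (\<psi> h p) = p" if "h \<in> carrier H" "p \<in> P" for h p
    using that by (simp flip: B.composition_rule)
  have "finite {p \<in> P. \<phi> (fst \<gamma> (\<psi> (snd \<gamma>) p)) x\<^sub>0 \<noteq> x\<^sub>0}" if \<gamma>: "\<gamma> \<in> \<Gamma>" for \<gamma>
  proof -
    let ?b = "\<lambda>p\<in>P. x\<^sub>0"
    have "?b \<in> restricted_product P X\<^sub>0 x\<^sub>0"
      using x\<^sub>0 by (auto simp: restricted_product_def)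
    then have "act \<gamma> ?b \<in> restricted_product P X\<^sub>0 x\<^sub>0"
      using sub(2)[OF \<gamma>] by blast
    moreover have "act \<gamma> ?b = (\<lambda>p\<in>P. \<phi> (fst \<gamma> p) x\<^sub>0)"
      using x\<^sub>0 comp[OF \<gamma>] by (auto simp: wreath_action_def fun_eq_iff split: prod.split)
    ultimately have "finite {p \<in> P. \<phi> (fst \<gamma> p) x\<^sub>0 \<noteq> x\<^sub>0}"
      by (simp add: restricted_product_def cong: conj_cong)
    moreover have "inj_on (\<psi> (snd \<gamma>)) P"
      using B.inj_prop comp[OF \<gamma>] by blast
    ultimately have "finite (\<psi> (snd \<gamma>) -` {p \<in> P. \<phi> (fst \<gamma> p) x\<^sub>0 \<noteq> x\<^sub>0} \<inter> P)"
      by (rule finite_vimage_IntI)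
    then show ?thesis
      by (rule rev_finite_subset) (use comp[OF \<gamma>] in auto)
  qed
  then show ?thesis
    using grp comp x\<^sub>0 A.group_action_axioms
    by (auto intro!: coordinate_action.intro coordinate_action_axioms.intro
        simp: preserving_wreath_product_def wreath_product_def B.composition_rule psi_inv PiE_iff)
qed

lemma act_fixes_iff:
  assumes \<gamma>: "\<gamma> \<in> carrier W" and y: "y \<in> P \<rightarrow>\<^sub>E X\<^sub>0"
  shows "act \<gamma> y = y \<longleftrightarrow> (\<forall>p\<in>P. \<phi> (fst \<gamma> (\<psi> (snd \<gamma>) p)) (y p) = y (\<psi> (snd \<gamma>) p))"
proof -
  obtain g h where gh: "\<gamma> = (g, h)" "h \<in> carrier H"
    using \<gamma> by (auto simp: wreath_product_def)
  have inv_h: "\<psi> (inv\<^bsub>H\<^esub> h) (\<psi> h p) = p" if "p \<in> P" for p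
    using that gh by (simp flip: B.composition_rule)
  have "act \<gamma> y = y \<longleftrightarrow> (\<forall>p\<in>P. act \<gamma> y p = y p)"
    using act_closed[OF \<gamma> y] y by (auto intro: PiE_ext)
  also have "\<dots> \<longleftrightarrow> (\<forall>p\<in>\<psi> h ` P. act \<gamma> y p = y p)"
    using gh by (simp add: B.surj_prop)
  also have "\<dots> \<longleftrightarrow> (\<forall>p\<in>P. \<phi> (g (\<psi> h p)) (y p) = y (\<psi> h p))"
    using gh y by (simp add: wreath_action_def inv_h)
  finally show ?thesis by (simp add: gh)
qed

end

theorem corollary1p8:
  fixes G\<^sub>0 :: "('g, 'm) monoid_scheme" and X\<^sub>0 :: "'x set" and \<phi> :: "'g \<Rightarrow> 'x \<Rightarrow> 'x" and x\<^sub>0 :: 'x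
    and H :: "('h, 'n) monoid_scheme" and P :: "'p set" and \<psi> :: "'h \<Rightarrow> 'p \<Rightarrow> 'p"
    and \<Gamma> :: "(('p \<Rightarrow> 'g) \<times> 'h) set" and N :: "nat \<Rightarrow> 'h set" and n :: nat and t :: 'h
  defines "X \<equiv> restricted_product P X\<^sub>0 x\<^sub>0"
    and "Gplus \<equiv> preserving_wreath_product G\<^sub>0 X\<^sub>0 \<phi> x\<^sub>0 H P \<psi>"
    and "act \<equiv> wreath_action H P X\<^sub>0 \<phi> \<psi>"
    and "proj\<Gamma> \<equiv> snd ` \<Gamma>"
  assumes "decent_action G\<^sub>0 X\<^sub>0 \<phi>" and "x\<^sub>0 \<in> X\<^sub>0"
    and "group_action H P \<psi>"
    and "subgroup \<Gamma> Gplus"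
    and "finitely_generated (Gplus\<lparr>carrier := \<Gamma>\<rparr>)"
    and "purely_elliptic (Gplus\<lparr>carrier := \<Gamma>\<rparr>) X act"
    and "1 \<le> n" and "N 0 = {\<one>\<^bsub>H\<^esub>}" and "N n = proj\<Gamma>"
    and "\<And>i. 1 \<le> i \<Longrightarrow> i \<le> n \<Longrightarrow> N i \<lhd> (H\<lparr>carrier := proj\<Gamma>\<rparr>)"
    and "\<And>i. 1 \<le> i \<Longrightarrow> i \<le> n \<Longrightarrow> N (i - 1) \<subseteq> N i"
    and "\<And>i. 1 \<le> i \<Longrightarrow> i \<le> n \<Longrightarrow> comm_group ((H\<lparr>carrier := N i\<rparr>) Mod N (i - 1))"
    and "t \<in> N 1"
    and "finite {Q \<in> orbits (H\<lparr>carrier := generate H {t}\<rparr>) P \<psi>. finite Q}"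
  shows "has_global_fixed_point (Gplus\<lparr>carrier := \<Gamma>\<rparr>) X act"
proof -
  interpret decent_action G\<^sub>0 X\<^sub>0 \<phi> by fact
  interpret B: group_action H P \<psi> by fact
  interpret wreath_data G\<^sub>0 X\<^sub>0 \<phi> H P \<psi> by unfold_locales
  define G where "G = Gplus\<lparr>carrier := \<Gamma>\<rparr>"
  define \<theta> where "\<theta> = (\<lambda>\<gamma> :: ('p \<Rightarrow> 'g) \<times> 'h. \<psi> (snd \<gamma>))"
  define \<alpha> where "\<alpha> = (\<lambda>(\<gamma> :: ('p \<Rightarrow> 'g) \<times> 'h) p. fst \<gamma> (\<psi> (snd \<gamma>) p))"
  interpret C: coordinate_action G G\<^sub>0 X\<^sub>0 \<phi> P \<theta> \<alpha> x\<^sub>0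
    using coordinate_action_preserving_subgroup \<open>subgroup \<Gamma> Gplus\<close> \<open>x\<^sub>0 \<in> X\<^sub>0\<close>
    unfolding G_def Gplus_def \<theta>_def \<alpha>_def by blast
  have carrier_G: "carrier G = \<Gamma>" by (simp add: G_def)
  have \<Gamma>_W: "\<Gamma> \<subseteq> carrier W"
    using subgroup.subset[OF \<open>subgroup \<Gamma> Gplus\<close>]
    by (auto simp: Gplus_def preserving_wreath_product_def)
  have fixes_iff: "act \<gamma> y = y \<longleftrightarrow> C.fixes_over P y \<gamma>" if "\<gamma> \<in> \<Gamma>" "y \<in> X" for \<gamma> y
    using act_fixes_iff[of \<gamma> y] \<Gamma>_W that
    unfolding C.fixes_over_def by (auto simp: \<theta>_def \<alpha>_def act_def X_def restricted_product_def)
  let ?Q = "H\<lparr>carrier := proj\<Gamma>\<rparr>"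
  have N1: "N 1 \<lhd> ?Q"
    using \<open>1 \<le> n\<close> by (intro assms) auto
  interpret N1: normal "N 1" ?Q by (rule N1)
  have proj_H: "proj\<Gamma> \<subseteq> carrier H"
    using \<Gamma>_W by (auto simp: proj\<Gamma>_def wreath_product_def)
  have mult_G: "snd (\<gamma> \<otimes>\<^bsub>G\<^esub> \<delta>) = snd \<gamma> \<otimes>\<^bsub>H\<^esub> snd \<delta>" for \<gamma> \<delta>
    by (simp add: G_def Gplus_def preserving_wreath_product_def wreath_product_def
        split: prod.splits)
  interpret proj: group_hom G ?Q snd
    by (intro group_hom.intro group_hom_axioms.intro homI C.group_axioms N1.group_axioms)
      (auto simp: carrier_G proj\<Gamma>_def mult_G)
  have hom_H: "group_hom G H snd"
    using proj_H by (intro group_hom.intro group_hom_axioms.intro homI C.group_axioms H.group_axioms)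
      (auto simp: carrier_G proj\<Gamma>_def mult_G)
  have N1_H: "N 1 \<subseteq> carrier H"
    using N1.subset proj_H by auto
  have "comm_group ((H\<lparr>carrier := N 1\<rparr>) Mod N (1 - 1))"
    using \<open>1 \<le> n\<close> by (intro assms) auto
  then have N1_comm: "a \<otimes>\<^bsub>H\<^esub> b = b \<otimes>\<^bsub>H\<^esub> a" if "a \<in> N 1" "b \<in> N 1" for a b
    using abelian_if_quotient_by_trivial_abelian[OF H.group_axioms N1_H _ that] \<open>N 0 = _\<close> by simp
  \<comment> \<open>The elements of \<open>\<Gamma>\<close> above \<open>N\<^sub>1\<close>: normal in \<open>\<Gamma>\<close>, and commuting with each other on \<open>P\<close>.\<close>
  define M where "M = {\<gamma> \<in> \<Gamma>. snd \<gamma> \<in> N 1}"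
  have M: "M \<lhd> G"
    unfolding C.normal_inv_iff
  proof (intro conjI ballI C.subgroupI)
    have "\<one>\<^bsub>G\<^esub> \<in> M"
      using C.one_closed proj.hom_one subgroup.one_closed[OF N1.subgroup_axioms] by (simp add: M_def flip: carrier_G)
    then show "M \<noteq> {}" by blast
    fix a assume "a \<in> M"
    then show "inv\<^bsub>G\<^esub> a \<in> M"
      using subgroup.m_inv_closed[OF N1.subgroup_axioms] by (auto simp: M_def simp flip: carrier_G)
  next
    fix a b assume "a \<in> M" "b \<in> M"
    then show "a \<otimes>\<^bsub>G\<^esub> b \<in> M"
      using subgroup.m_closed[OF N1.subgroup_axioms] by (auto simp: M_def mult_G simp flip: carrier_G)
  next
    fix a b assume "a \<in> carrier G" "b \<in> M"
    then show "a \<otimes>\<^bsub>G\<^esub> b \<otimes>\<^bsub>G\<^esub> inv\<^bsub>G\<^esub> a \<in> M"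
      using N1.inv_op_closed2[of "snd a" "snd b"] proj.hom_closed[of a]
      by (auto simp: M_def mult_G simp flip: carrier_G)
  qed (auto simp: M_def carrier_G)
  obtain \<tau> where \<tau>: "\<tau> \<in> M" "snd \<tau> = t"
    using \<open>t \<in> N 1\<close> N1.subset by (auto simp: M_def proj\<Gamma>_def)
  have tH: "t \<in> carrier H" using N1_H \<open>t \<in> N 1\<close> by blast
  have "\<theta> (\<tau> [^]\<^bsub>G\<^esub> k) p = \<psi> (t [^]\<^bsub>H\<^esub> k) p" for k :: int and p
    using group_hom.hom_int_pow[OF hom_H, of \<tau> k] \<tau> by (simp add: \<theta>_def M_def carrier_G)
  then have cyc: "range (\<lambda>k::int. \<theta> (\<tau> [^]\<^bsub>G\<^esub> k) p) = orbit (H\<lparr>carrier := generate H {t}\<rparr>) \<psi> p" for p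
    by (auto simp: orbit_def H.generate_pow[OF tH])
  have "\<exists>z\<in>X. \<forall>\<gamma>\<in>carrier G. C.fixes_over P z \<gamma>"
    unfolding X_def
  proof (rule C.global_fixed_point[OF _ _ _ M _ \<tau>(1)])
    show "\<exists>y\<in>restricted_product P X\<^sub>0 x\<^sub>0. C.fixes_over P y \<gamma>" if "\<gamma> \<in> carrier G" for \<gamma>
      using \<open>purely_elliptic (Gplus\<lparr>carrier := \<Gamma>\<rparr>) X act\<close> fixes_iff that
      by (auto simp: purely_elliptic_def carrier_G simp flip: X_def)
    show "\<theta> a (\<theta> b p) = \<theta> b (\<theta> a p)" if "a \<in> M" "b \<in> M" "p \<in> P" for a b p
      using that N1_comm[of "snd a" "snd b"] N1_H
      by (auto simp: \<theta>_def M_def subset_iff simp flip: B.composition_rule)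
    have "{p \<in> P. finite (range (\<lambda>k::int. \<theta> (\<tau> [^]\<^bsub>G\<^esub> k) p))}
        \<subseteq> \<Union> {Q \<in> orbits (H\<lparr>carrier := generate H {t}\<rparr>) P \<psi>. finite Q}"
    proof
      fix p assume "p \<in> {p \<in> P. finite (range (\<lambda>k::int. \<theta> (\<tau> [^]\<^bsub>G\<^esub> k) p))}"
      then have p: "p \<in> P" "finite (orbit (H\<lparr>carrier := generate H {t}\<rparr>) \<psi> p)"
        using cyc by auto
      have "p \<in> orbit (H\<lparr>carrier := generate H {t}\<rparr>) \<psi> p"
        unfolding orbit_def using p(1) generate.one[of H "{t}"] psi_one[OF p(1)] by force
      with p show "p \<in> \<Union> {Q \<in> orbits (H\<lparr>carrier := generate H {t}\<rparr>) P \<psi>. finite Q}"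
        by (auto simp: orbits_def)
    qed
    then show "finite {p \<in> P. finite (range (\<lambda>k::int. \<theta> (\<tau> [^]\<^bsub>G\<^esub> k) p))}"
      by (rule finite_subset)
        (use \<open>finite {Q \<in> orbits (H\<lparr>carrier := generate H {t}\<rparr>) P \<psi>. finite Q}\<close> in auto)
    show "decent_action G\<^sub>0 X\<^sub>0 \<phi>" by fact
    show "finitely_generated G"
      using \<open>finitely_generated (Gplus\<lparr>carrier := \<Gamma>\<rparr>)\<close> by (simp add: G_def)
  qed
  then show ?thesis
    using fixes_iff by (auto simp: has_global_fixed_point_def carrier_G G_def)
qed

end
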